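(* Let $0<p<1/2$, $\rho=(1-p)/p$. Suppose that $|u_+(n)-u_+(n-1)|$ is bounded over $n\in\{1,2,\dots\}$ and that the probability weighting function $w_+$ satisfies $$\limsup_{n\to\infty}\Big|w_+\Big(\frac1{\rho^n-1}\Big)\Big|^{1/n}<1 .$$ Then the following problem (InP) has a finite optimal value: maximize $$v(\mathbf{z}_{+,-})=\sum_{n=1}^\infty u_+(n)\big(w_+(z_{+,n})-w_+(z_{+,n+1})\big)-\sum_{n=1}^\infty u_-(n)\big(w_-(z_{-,n})-w_-(z_{-,n+1})\big)$$ over $\mathbf{z}_{+,-}=(z_{+,1},z_{+,2},\dots;z_{-,1},z_{-,2},\dots)$ subject to $$1\ge z_{+,1}\ge z_{+,2}\ge\dots\ge 0,\quad 1\ge z_{-,1}\ge z_{-,2}\ge\dots\ge0,\quad z_{+,1}+z_{-,1}\le 1,$$ $$\sum_{n=1}^\infty z_{+,n}+\sum_{n=1}^\infty z_{-,n}<\infty,\qquad \frac1{1-p}\sum_{n=1}^\infty\rho^n z_{+,n}-\frac1p\sum_{n=1}^\infty\rho^{-n}z_{-,n}\le 0 .$$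
   Context: $u_\pm:[0,\infty)\to[0,\infty)$ are the utility in gains and disutility in losses, nondecreasing with $u_\pm(0)=0$; $w_\pm:[0,1]\to[0,1]$ are probability weighting functions, nondecreasing with $w_\pm(0)=0$, $w_\pm(1)=1$. Convention: $v(\mathbf{z}_{+,-})=-\infty$ if the second infinite sum in $v$ is infinite. In the limsup condition only $n$ large enough that $1/(\rho^n-1)\le1$ matter. *)

theory Defs
  imports Complex_Main "HOL-Library.Extended_Real" "HOL-Library.FuncSet"
begin

text \<open>
  Functions on \<open>[0,\<infinity>)\<close> and \<open>[0,1]\<close> are total functions on the reals that are only
  constrained on these sets.
\<close>

definition utility :: "(real \<Rightarrow> real) \<Rightarrow> bool" where
  "utility u \<longleftrightarrow> u \<in> {0..} \<rightarrow> {0..} \<and> mono_on {0..} u \<and> u 0 = 0"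

definition weighting :: "(real \<Rightarrow> real) \<Rightarrow> bool" where
  "weighting w \<longleftrightarrow> w \<in> {0..1} \<rightarrow> {0..1} \<and> mono_on {0..1} w \<and> w 0 = 0 \<and> w 1 = 1"

text \<open>
  Sequences are indexed from 1; the entry at index 0 is never used. All infinite sums are
  taken in the extended reals, where on the feasible set every series has nonnegative terms.
\<close>

definition choquet_sum :: "(real \<Rightarrow> real) \<Rightarrow> (real \<Rightarrow> real) \<Rightarrow> (nat \<Rightarrow> real) \<Rightarrow> ereal" where
  "choquet_sum u w z = (\<Sum>k. let n = Suc k in ereal (u (real n) * (w (z n) - w (z (n + 1)))))"

text \<open>The case distinction is needed because \<open>\<infinity> - \<infinity> = \<infinity>\<close> for type \<^typ>\<open>ereal\<close>.\<close>

definition objective ::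
  "(real \<Rightarrow> real) \<Rightarrow> (real \<Rightarrow> real) \<Rightarrow> (real \<Rightarrow> real) \<Rightarrow> (real \<Rightarrow> real) \<Rightarrow>
    (nat \<Rightarrow> real) \<times> (nat \<Rightarrow> real) \<Rightarrow> ereal" where
  "objective up um wp wm = (\<lambda>(zp, zm).
     if choquet_sum um wm zm = \<infinity> then -\<infinity>
     else choquet_sum up wp zp - choquet_sum um wm zm)"

definition feasible :: "real \<Rightarrow> ((nat \<Rightarrow> real) \<times> (nat \<Rightarrow> real)) set" where
  "feasible p = (let \<rho> = (1 - p) / p in {(zp, zm).
     zp 1 \<le> 1 \<and> (\<forall>n\<ge>1. zp (n + 1) \<le> zp n \<and> 0 \<le> zp n) \<and>
     zm 1 \<le> 1 \<and> (\<forall>n\<ge>1. zm (n + 1) \<le> zm n \<and> 0 \<le> zm n) \<and>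
     zp 1 + zm 1 \<le> 1 \<and>
     (\<Sum>k. ereal (zp (Suc k))) + (\<Sum>k. ereal (zm (Suc k))) < \<infinity> \<and>
     ereal (1 / (1 - p)) * (\<Sum>k. ereal (\<rho> ^ Suc k * zp (Suc k)))
       - ereal (1 / p) * (\<Sum>k. ereal (zm (Suc k) / \<rho> ^ Suc k)) \<le> 0})"

definition optimal_value ::
  "real \<Rightarrow> (real \<Rightarrow> real) \<Rightarrow> (real \<Rightarrow> real) \<Rightarrow> (real \<Rightarrow> real) \<Rightarrow> (real \<Rightarrow> real) \<Rightarrow> ereal" where
  "optimal_value p up um wp wm = (SUP z\<in>feasible p. objective up um wp wm z)"

end

theory Submission
  imports Defs
begin

text \<open>
  On the feasible set \<open>\<rho>\<^sup>1 + \<dots> + \<rho>\<^sup>n\<close> times \<open>z\<^sub>+\<^sub>,\<^sub>n\<close> is at most \<open>\<Sum>k. \<rho>^k z\<^sub>+\<^sub>,\<^sub>k\<close>, which the budget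
  constraint and \<open>z\<^sub>-\<^sub>,\<^sub>k \<le> 1\<close> bound by \<open>\<rho> / (\<rho> - 1)\<close>; hence \<open>z\<^sub>+\<^sub>,\<^sub>n \<le> 1 / (\<rho>^n - 1)\<close>. By the root
  condition \<open>w\<^sub>+ z\<^sub>+\<^sub>,\<^sub>n\<close> is then dominated by a summable sequence that does not depend on the
  feasible point, and summation by parts bounds the gain part by \<open>sup (u\<^sub>+ n - u\<^sub>+ (n - 1))\<close> times
  the sum of that sequence.
\<close>

lemma antimono_from_oneD:
  fixes z :: "nat \<Rightarrow> real"
  assumes "\<forall>n\<ge>1. z (n + 1) \<le> z n" and "1 \<le> m" and "m \<le> n"
  shows "z n \<le> z m"
  using assms(3)
proof (induction n rule: dec_induct)
  case (step n)
  then show ?case using assms(1)[rule_format, of n] assms(2) by simp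
qed simp

lemma sum_by_parts_le:
  fixes f g :: "nat \<Rightarrow> real"
  assumes "f 0 = 0" and "\<And>n. 0 \<le> f n" and "\<And>n. 0 \<le> g (Suc n)"
    and "\<And>n. f (Suc n) - f n \<le> L"
  shows "(\<Sum>k<N. f (Suc k) * (g (Suc k) - g (Suc (Suc k)))) \<le> L * (\<Sum>k<N. g (Suc k))"
proof -
  have "(\<Sum>k<N. f (Suc k) * (g (Suc k) - g (Suc (Suc k))))
      = (\<Sum>k<N. (f (Suc k) - f k) * g (Suc k)) - f N * g (Suc N)"
    by (induction N) (auto simp: assms(1) algebra_simps)
  also have "\<dots> \<le> (\<Sum>k<N. (f (Suc k) - f k) * g (Suc k))"
    using assms(2,3) by simp
  also have "\<dots> \<le> (\<Sum>k<N. L * g (Suc k))"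
    by (intro sum_mono mult_right_mono assms)
  finally show ?thesis by (simp add: sum_distrib_left)
qed

lemma choquet_term_nonneg:
  assumes "utility u" and "weighting w"
    and "z 1 \<le> 1" and "\<forall>n\<ge>1. z (n + 1) \<le> z n \<and> 0 \<le> z n"
  shows "0 \<le> u (real (Suc k)) * (w (z (Suc k)) - w (z (Suc (Suc k))))"
proof -
  have unit: "z (Suc n) \<in> {0..1}" for n
    using antimono_from_oneD[of z 1 "Suc n"] assms(3,4) by force
  have "w (z (Suc (Suc k))) \<le> w (z (Suc k))"
    using assms(2,4) unit by (auto simp: weighting_def intro: mono_onD)
  moreover have "0 \<le> u (real (Suc k))"
    using assms(1) by (auto simp: utility_def Pi_iff)
  ultimately show ?thesis by simp
qed

lemma choquet_sum_nonneg:
  assumes "utility u" and "weighting w"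
    and "z 1 \<le> 1" and "\<forall>n\<ge>1. z (n + 1) \<le> z n \<and> 0 \<le> z n"
  shows "0 \<le> choquet_sum u w z"
  unfolding choquet_sum_def Let_def
  using choquet_term_nonneg[OF assms] by (intro suminf_nonneg summable_ereal_pos) auto

lemma choquet_sum_le:
  assumes u: "utility u" and w: "weighting w"
    and z: "z 1 \<le> 1" "\<forall>n\<ge>1. z (n + 1) \<le> z n \<and> 0 \<le> z n"
    and L: "\<And>n. u (real (Suc n)) - u (real n) \<le> L"
    and g: "\<And>k. w (z (Suc k)) \<le> g k" "summable g"
  shows "choquet_sum u w z \<le> ereal (L * suminf g)"
  unfolding choquet_sum_def Let_def
proof (rule suminf_bound, rule allI)
  have w0: "0 \<le> w (z (Suc n))" for n
    using antimono_from_oneD[of z 1 "Suc n"] z w by (force simp: weighting_def Pi_iff)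
  have u0: "0 \<le> u (real n)" "u 0 = 0" for n
    using u by (auto simp: utility_def Pi_iff)
  \<comment> \<open>The first increment, \<open>u 1 - u 0 = u 1\<close>, is nonnegative and at most
    \<open>L\<close>.\<close>
  have L0: "0 \<le> L"
    using L[of 0] u0(1)[of 1] u0(2) by simp
  fix N
  have "(\<Sum>k<N. u (real (Suc k)) * (w (z (Suc k)) - w (z (Suc (Suc k)))))
      \<le> L * (\<Sum>k<N. w (z (Suc k)))"
    using sum_by_parts_le[of "\<lambda>n. u (real n)" "\<lambda>n. w (z n)" L N] u0 w0 L by simp
  also have "\<dots> \<le> L * (\<Sum>k<N. g k)"
    by (intro mult_left_mono sum_mono g L0)
  also have "\<dots> \<le> L * suminf g"
    by (intro mult_left_mono sum_le_suminf L0 g ballI order_trans[OF w0 g(1)]) auto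
  finally show "(\<Sum>k<N. ereal (u (real (Suc k)) * (w (z (Suc k)) - w (z (Suc k + 1)))))
      \<le> ereal (L * suminf g)"
    by simp
next
  fix n
  show "0 \<le> ereal (u (real (Suc n)) * (w (z (Suc n)) - w (z (Suc n + 1))))"
    using choquet_term_nonneg[OF u w z, of n] by simp
qed

lemma feasible_gain_le:
  fixes p \<rho> :: real
  assumes p: "0 < p" "p < 1 / 2" and \<rho>: "\<rho> = (1 - p) / p"
    and f: "(zp, zm) \<in> feasible p" and n: "1 \<le> n"
  shows "zp n \<le> 1 / (\<rho> ^ n - 1)"
proof -
  have \<rho>1: "1 < \<rho>" using p by (simp add: \<rho> field_simps)
  have zp: "\<forall>n\<ge>1. zp (n + 1) \<le> zp n" "\<And>n. 1 \<le> n \<Longrightarrow> 0 \<le> zp n"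
    and zm: "\<forall>n\<ge>1. zm (n + 1) \<le> zm n" "\<And>n. 1 \<le> n \<Longrightarrow> 0 \<le> zm n" "zm 1 \<le> 1"
    using f by (auto simp: feasible_def Let_def)
  define S where "S = (\<Sum>k. ereal (\<rho> ^ Suc k * zp (Suc k)))"
  define T where "T = (\<Sum>k. ereal (zm (Suc k) / \<rho> ^ Suc k))"
  have ST: "ereal (1 / (1 - p)) * S - ereal (1 / p) * T \<le> 0"
    using f unfolding feasible_def Let_def \<rho>[symmetric] S_def T_def by auto
  have geo: "(\<lambda>k. (1 / \<rho>) ^ Suc k) sums (1 / (\<rho> - 1))"
    using sums_mult[OF geometric_sums[of "1 / \<rho>"], of "1 / \<rho>"] \<rho>1
    by (simp add: field_simps)
  have T0: "0 \<le> T"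
    unfolding T_def using zm(2) \<rho>1 by (intro suminf_nonneg summable_ereal_pos) auto
  have T1: "T \<le> ereal (1 / (\<rho> - 1))"
    unfolding T_def
  proof (rule suminf_bound, rule allI)
    fix N
    have "(\<Sum>k<N. zm (Suc k) / \<rho> ^ Suc k) \<le> (\<Sum>k<N. (1 / \<rho>) ^ Suc k)"
    proof (rule sum_mono)
      fix k
      have "zm (Suc k) \<le> 1"
        using antimono_from_oneD[OF zm(1), of 1 "Suc k"] zm(3) by simp
      then show "zm (Suc k) / \<rho> ^ Suc k \<le> (1 / \<rho>) ^ Suc k"
        using \<rho>1 by (simp add: power_one_over divide_right_mono del: power_Suc)
    qed
    also have "\<dots> \<le> (\<Sum>k. (1 / \<rho>) ^ Suc k)"
      using \<rho>1 geo by (intro sum_le_suminf) (auto simp: sums_iff)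
    also have "\<dots> = 1 / (\<rho> - 1)" using geo by (simp add: sums_iff)
    finally show "(\<Sum>k<N. ereal (zm (Suc k) / \<rho> ^ Suc k)) \<le> ereal (1 / (\<rho> - 1))"
      by simp
  qed (use zm(2) \<rho>1 in auto)
  have "ereal (\<Sum>k<n. \<rho> ^ Suc k * zp (Suc k)) \<le> S"
    unfolding S_def sum_ereal[symmetric] using zp(2) \<rho>1
    by (intro sum_le_suminf summable_ereal_pos) auto
  moreover have "(\<Sum>k<n. \<rho> ^ Suc k * zp n) \<le> (\<Sum>k<n. \<rho> ^ Suc k * zp (Suc k))"
    using antimono_from_oneD[OF zp(1)] \<rho>1 by (intro sum_mono mult_left_mono) auto
  ultimately have S: "ereal ((\<Sum>k<n. \<rho> ^ Suc k) * zp n) \<le> S"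
    by (simp add: sum_distrib_right order_trans[rotated])
  \<comment> \<open>With \<open>T\<close> finite, the budget constraint excludes
    \<open>S = \<infinity>\<close>, and the lower bound on \<open>S\<close> excludes
    \<open>-\<infinity>\<close>; what remains is real arithmetic.\<close>
  obtain t where t: "T = ereal t" "t \<le> 1 / (\<rho> - 1)"
    using T0 T1 by (cases T) auto
  have "(1 / (1 - p)) * ((\<Sum>k<n. \<rho> ^ Suc k) * zp n) \<le> (1 / p) * t"
  proof (cases S)
    case (real s)
    have "(1 / (1 - p)) * s \<le> (1 / p) * t"
      using ST by (simp add: real t)
    moreover have "(1 / (1 - p)) * ((\<Sum>k<n. \<rho> ^ Suc k) * zp n) \<le> (1 / (1 - p)) * s"
      using S p by (intro mult_left_mono) (auto simp: real)
    ultimately show ?thesis by linarith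
  qed (use S ST p t in auto)
  also have "\<dots> \<le> (1 / p) * (1 / (\<rho> - 1))"
    using t p by (intro mult_left_mono) auto
  \<comment> \<open>Multiplying by \<open>1 - p\<close> clears the left factor and turns
    \<open>1 / p\<close> into \<open>\<rho>\<close>, so that the factor
    \<open>\<rho> / (\<rho> - 1)\<close> of the geometric sum appears on both sides and
    cancels.\<close>
  finally have "(1 - p) * (1 / (1 - p) * ((\<Sum>k<n. \<rho> ^ Suc k) * zp n))
      \<le> (1 - p) * (1 / p * (1 / (\<rho> - 1)))"
    using p by (intro mult_left_mono) auto
  moreover have "(1 - p) * (1 / p * x) = \<rho> * x" "(1 - p) * (1 / (1 - p) * x) = x" for x
    using p by (simp_all add: \<rho>)
  ultimately have "(\<Sum>k<n. \<rho> ^ Suc k) * zp n \<le> \<rho> * (1 / (\<rho> - 1))"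
    by metis
  moreover have "(\<Sum>k<n. \<rho> ^ Suc k) = \<rho> * ((\<rho> ^ n - 1) / (\<rho> - 1))"
    using \<rho>1 geometric_sum[of \<rho> n] by (simp add: sum_distrib_left[symmetric])
  ultimately have "\<rho> / (\<rho> - 1) * ((\<rho> ^ n - 1) * zp n) \<le> \<rho> / (\<rho> - 1) * 1"
    by (simp only: times_divide_eq_left times_divide_eq_right mult.assoc mult_1_right)
  then have "(\<rho> ^ n - 1) * zp n \<le> 1"
    using \<rho>1 by (subst (asm) mult_le_cancel_left_pos) auto
  moreover have "1 < \<rho> ^ n"
    using \<rho>1 n by (intro one_less_power) auto
  ultimately show ?thesis by (simp add: field_simps)
qed

text \<open>Cauchy's root test: for \<open>r\<close> strictly between the limsup and 1, the terms
  are eventually dominated by the geometric sequence \<open>r ^ n\<close>.\<close>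

lemma summable_limsup_root_less_one:
  fixes a :: "nat \<Rightarrow> real"
  assumes "limsup (\<lambda>n. ereal (\<bar>a n\<bar> powr (1 / real n))) < 1"
  shows "summable (\<lambda>n. \<bar>a n\<bar>)"
proof -
  obtain r where r: "limsup (\<lambda>n. ereal (\<bar>a n\<bar> powr (1 / real n))) < ereal r" "ereal r < 1"
    using ereal_dense2[OF assms] by blast
  have "eventually (\<lambda>n. ereal (\<bar>a n\<bar> powr (1 / real n)) < ereal r) sequentially"
    using r(1) by (rule Limsup_lessD)
  then obtain N where N: "\<And>n. N \<le> n \<Longrightarrow> \<bar>a n\<bar> powr (1 / real n) < r"
    by (auto simp: eventually_sequentially)
  have r0: "0 < r"
    using N[of N] by (meson le_less_trans order_refl powr_ge_zero)
  \<comment> \<open>Index 0 is excluded because \<open>1 / real 0 = 0\<close>, so there the power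
    cannot undo the root.\<close>
  have "norm \<bar>a n\<bar> \<le> r ^ n" if "max N 1 \<le> n" for n
  proof -
    have "(\<bar>a n\<bar> powr (1 / real n)) powr real n \<le> r powr real n"
      using N[of n] that by (intro powr_mono2) auto
    then show ?thesis
      using that r0 by (simp add: powr_powr powr_realpow)
  qed
  moreover have "summable (\<lambda>n. r ^ n)"
    using r0 r(2) by (simp add: summable_geometric)
  ultimately show ?thesis
    using summable_comparison_test'[of "\<lambda>n. r ^ n" "max N 1" "\<lambda>n. \<bar>a n\<bar>"] by blast
qed

theorem proposition4p1:
  fixes p \<rho> :: real and up um wp wm :: "real \<Rightarrow> real"
  assumes "0 < p" and "p < 1 / 2" and "\<rho> = (1 - p) / p"
    and "utility up" and "utility um" and "weighting wp" and "weighting wm"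
    and "bdd_above ((\<lambda>n::nat. \<bar>up (real n) - up (real n - 1)\<bar>) ` {1..})"
    and "limsup (\<lambda>n. ereal (\<bar>wp (1 / (\<rho> ^ n - 1))\<bar> powr (1 / real n))) < 1"
  shows "\<bar>optimal_value p up um wp wm\<bar> \<noteq> \<infinity>"
proof -
  obtain L where L': "\<And>n::nat. 1 \<le> n \<Longrightarrow> \<bar>up (real n) - up (real n - 1)\<bar> \<le> L"
    using assms(8) by (auto simp: bdd_above_def)
  have L: "up (real (Suc n)) - up (real n) \<le> L" for n
    using L'[of "Suc n"] by (simp add: abs_le_iff)
  have \<rho>1: "1 < \<rho>" using assms(1,2) by (simp add: assms(3) field_simps)
  \<comment> \<open>For small \<open>n\<close> the argument of \<open>wp\<close> may lie outside \<open>[0,1]\<close>, where \<open>wp\<close> is arbitrary.\<close>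
  define g where "g k = (if 1 / (\<rho> ^ Suc k - 1) \<le> 1 then \<bar>wp (1 / (\<rho> ^ Suc k - 1))\<bar> else 1)" for k
  have "summable g"
  proof -
    \<comment> \<open>Once \<open>\<rho> ^ Suc k\<close> exceeds 2, the argument of
      \<open>wp\<close> is below 1. Hence the fallback value 1 occurs in \<open>g\<close> only
      finitely often and does not affect summability.\<close>
    obtain N where N: "2 < \<rho> ^ N" using real_arch_pow[OF \<rho>1] by blast
    have "1 / (\<rho> ^ Suc k - 1) \<le> 1" if "N \<le> k" for k
    proof -
      have "\<rho> ^ N \<le> \<rho> ^ Suc k"
        using \<rho>1 that by (intro power_increasing) auto
      then have "2 < \<rho> ^ Suc k" using N by (rule less_le_trans[rotated])
      then show ?thesis by (simp add: field_simps del: power_Suc)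
    qed
    then have "eventually (\<lambda>k. g k = \<bar>wp (1 / (\<rho> ^ Suc k - 1))\<bar>) sequentially"
      unfolding eventually_sequentially g_def by (intro exI[of _ N]) (simp del: power_Suc)
    moreover have "summable (\<lambda>k. \<bar>wp (1 / (\<rho> ^ Suc k - 1))\<bar>)"
      using summable_limsup_root_less_one[OF assms(9)] by (subst summable_Suc_iff)
    ultimately show ?thesis by (simp add: summable_cong del: power_Suc)
  qed
  have w1: "wp x \<le> 1" if "x \<in> {0..1}" for x
    using assms(6) that by (auto simp: weighting_def Pi_iff)
  have upper: "objective up um wp wm z \<le> ereal (L * suminf g)" if "z \<in> feasible p" for z
  proof -
    obtain zp zm where z: "z = (zp, zm)" by fastforce
    have zp: "zp 1 \<le> 1" "\<forall>n\<ge>1. zp (n + 1) \<le> zp n \<and> 0 \<le> zp n"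
      and zm: "zm 1 \<le> 1" "\<forall>n\<ge>1. zm (n + 1) \<le> zm n \<and> 0 \<le> zm n"
      using that by (auto simp: z feasible_def Let_def)
    have "wp (zp (Suc k)) \<le> g k" for k
    proof -
      let ?b = "1 / (\<rho> ^ Suc k - 1)"
      have b: "zp (Suc k) \<le> ?b"
        using feasible_gain_le[OF assms(1-3), of zp zm "Suc k"] that by (simp add: z)
      have unit: "zp (Suc k) \<in> {0..1}"
        using antimono_from_oneD[of zp 1 "Suc k"] zp by force
      \<comment> \<open>Monotonicity of \<open>wp\<close> is available only on [0,1];
        \<open>?b\<close> is nonnegative because it lies above \<open>zp (Suc k)\<close>. If
        \<open>?b\<close> exceeds 1, the trivial bound \<open>wp \<le> 1\<close> on [0,1] matches
        the other branch of \<open>g\<close>.\<close>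
      have "wp (zp (Suc k)) \<le> wp ?b" if "?b \<le> 1"
      proof (rule mono_onD[of "{0..1}" wp])
        show "?b \<in> {0..1}"
          using order_trans[OF _ b, of 0] unit that unfolding atLeastAtMost_iff by blast
      qed (use assms(6) b unit in \<open>auto simp: weighting_def\<close>)
      then show ?thesis
        using w1[OF unit] unfolding g_def by (cases "?b \<le> 1") (auto simp del: power_Suc)
    qed
    then have "choquet_sum up wp zp \<le> ereal (L * suminf g)"
      using zp L \<open>summable g\<close> assms(4,6) by (intro choquet_sum_le) auto
    moreover have "0 \<le> choquet_sum um wm zm"
      using zm assms(5,7) by (intro choquet_sum_nonneg) auto
    moreover have "a - b \<le> a" if "0 \<le> b" for a b :: ereal
      using that by (cases a; cases b) auto
    ultimately show ?thesis
      by (auto simp: z objective_def intro: order_trans)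
  qed
  \<comment> \<open>The zero pair has objective value 0, so the supremum is not
    \<open>-\<infinity>\<close>; the uniform upper bound excludes
    \<open>\<infinity>\<close>.\<close>
  have "(\<lambda>_. 0, \<lambda>_. 0) \<in> feasible p"
    by (auto simp: feasible_def Let_def zero_ereal_def[symmetric])
  then have "objective up um wp wm (\<lambda>_. 0, \<lambda>_. 0) \<le> optimal_value p up um wp wm"
    unfolding optimal_value_def by (rule SUP_upper)
  then have "0 \<le> optimal_value p up um wp wm"
    by (simp add: objective_def choquet_sum_def zero_ereal_def[symmetric])
  moreover have "optimal_value p up um wp wm \<le> ereal (L * suminf g)"
    unfolding optimal_value_def using upper by (rule SUP_least)
  ultimately show ?thesis by (cases "optimal_value p up um wp wm") auto
qed

end
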